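(* Let $k,r$ be positive integers, $d=k$, $n=d+r$, and $B=k(2d+r-k)=kn$. Let $q$ be a prime power and let $\mathbf{G}=[\mathbf{v}_1\ \mathbf{v}_2\ \cdots\ \mathbf{v}_{n-1}]$ be a $k\times(n-1)$ generator matrix over $GF(q)$ of a maximum-distance separable code of length $n-1$ and dimension $k$ (so any $k$ columns of $\mathbf{G}$ are linearly independent). Let a file consist of $B=kn$ packets in $GF(q)$, arranged as $n$ row vectors $\mathbf{x}_1,\dots,\mathbf{x}_n\in GF(q)^k$. For $i=1,\dots,n$, let node $i$ store the $k$ entries of $\mathbf{x}_i$ together with the $n-1$ packets $$\mathbf{x}_{i\oplus 1}\cdot\mathbf{v}_1,\ \ \mathbf{x}_{i\oplus 2}\cdot\mathbf{v}_2,\ \dots,\ \mathbf{x}_{i\oplus(n-1)}\cdot\mathbf{v}_{n-1},$$ where $\oplus$ is addition modulo $n$ with representatives in $\{1,\dots,n\}$. Then: (1) (File reconstruction) For any $k$ of the $n$ nodes, the whole file $(\mathbf{x}_1,\dots,\mathbf{x}_n)$ is determined by the contents of these $k$ nodes. (2) (Exact cooperative repair) For any set of $r$ failed nodes, the exact contents of all $r$ failed nodes can be recovered by a two-phase cooperative repair in which each newcomer receives $2$ packets from each of the $d=k$ surviving nodes in the first phase and $1$ packet from each of the other $r-1$ newcomers in the second phase. Hence a total of $r(2d+r-1)$ packets is transmitted, and the repair-bandwidth per failed node is $$2d+r-1=\frac{B(2d+r-1)}{k(2d+r-k)},$$ i.e. it matches the lower bound $\frac{B(2d+r-1)}{k(2d+r-k)}$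 on the repair-bandwidth per failed node in cooperative repair.
   Context: The index operation is $x\oplus y=x+y$ if $x+y\le n$ and $x\oplus y=x+y-n$ if $x+y>n$, for $x, y\in\{1,\dots,n\}$. The symbol "$\cdot$" is the dot product over $GF(q)$ of a row vector of length $k$ with a column vector of length $k$. A packet is an element of $GF(q)$. Two-phase cooperative repair: when $r$ of the $n$ nodes fail, each is replaced by a newcomer. In the first phase each newcomer receives packets from $d$ surviving nodes (here $n-r=d$, so all survivors), each packet being a function of the content of the surviving node sending it. In the second phase, the newcomers exchange packets among themselves, each packet sent by a newcomer being a function of the packets it received in the first phase. Exact repair means that, from all the packets it received in both phases, each newcomer computes exactly the content that was stored in the failed node it replaces. The repair-bandwidth per failed node is the number of packets received by each newcomer over the two phases. The lower bound referred to: for file size $B$ and parameters $n,k,d,r$ with $d\ge k$, if each newcomer downloads $\beta_1$ packets from each of $d$ survivors and receives $\beta_2$ packets from each of the other $r-1$ newcomers, then $d\beta_1+(r-1)\beta_2\ge\frac{B(2d+r-1)}{k(2d+r-k)}$. *)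

theory Defs
  imports "Jordan_Normal_Form.VS_Connect"
begin

section \<open>Linear codes\<close>

text \<open>Codes of length \<open>N\<close> over a finite field are subspaces of the space of row vectors of
  dimension \<open>N\<close>.  The field \<open>GF(q)\<close> is a type of class \<open>field\<close> and \<open>finite\<close>.\<close>

definition linear_code :: "nat \<Rightarrow> nat \<Rightarrow> 'a::field vec set \<Rightarrow> bool" where
  "linear_code N k C \<longleftrightarrow>
     subspace class_ring C (module_vec TYPE('a) N) \<and>
     vectorspace.dim class_ring ((module_vec TYPE('a) N)\<lparr>carrier := C\<rparr>) = k"

definition hamming_distance :: "'a vec \<Rightarrow> 'a vec \<Rightarrow> nat" where
  "hamming_distance u w = card {i. i < dim_vec u \<and> u $ i \<noteq> w $ i}"

definition min_distance :: "'a vec set \<Rightarrow> nat" where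
  "min_distance C = Inf {hamming_distance u w | u w. u \<in> C \<and> w \<in> C \<and> u \<noteq> w}"

text \<open>Maximum-distance separable: equality in the Singleton bound.\<close>

definition mds_code :: "nat \<Rightarrow> nat \<Rightarrow> 'a::field vec set \<Rightarrow> bool" where
  "mds_code N k C \<longleftrightarrow> linear_code N k C \<and> min_distance C = N - k + 1"

definition generator_matrix :: "nat \<Rightarrow> nat \<Rightarrow> 'a::field vec set \<Rightarrow> 'a mat \<Rightarrow> bool" where
  "generator_matrix N k C G \<longleftrightarrow>
     G \<in> carrier_mat k N \<and> distinct (rows G) \<and>
     module.lin_indpt class_ring (module_vec TYPE('a) N) (set (rows G)) \<and>
     vec_space.row_space N G = C"


section \<open>The storage scheme\<close>

text \<open>Addition modulo \<open>n\<close> with representatives in \<open>{1..n}\<close>, for arguments in \<open>{1..n}\<close>.\<close>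

definition node_add :: "nat \<Rightarrow> nat \<Rightarrow> nat \<Rightarrow> nat" where
  "node_add n x y = (if x + y \<le> n then x + y else x + y - n)"

definition files :: "nat \<Rightarrow> nat \<Rightarrow> (nat \<Rightarrow> 'a vec) set" where
  "files n k = {1..n} \<rightarrow>\<^sub>E carrier_vec k"

text \<open>Columns of \<open>G\<close> are indexed from 0, so the \<open>j\<close>-th column vector \<open>v\<^sub>j\<close> is \<open>col G (j - 1)\<close>.\<close>

definition node_content :: "'a::field mat \<Rightarrow> nat \<Rightarrow> (nat \<Rightarrow> 'a vec) \<Rightarrow> nat \<Rightarrow> 'a list" where
  "node_content G n x i =
     list_of_vec (x i) @ map (\<lambda>j. x (node_add n i j) \<bullet> col G (j - 1)) [1..<n]"


section \<open>Two-phase cooperative repair\<close>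

text \<open>\<open>send1 P s t\<close> computes the packets that survivor \<open>s\<close> sends to newcomer \<open>t\<close> from the content
  of \<open>s\<close>; \<open>send2 P u t\<close> computes the packets that newcomer \<open>u\<close> sends to newcomer \<open>t\<close> from the
  packets received by \<open>u\<close> in the first phase; \<open>recover P t\<close> computes the new content of \<open>t\<close> from the
  packets received by \<open>t\<close> in the first and in the second phase.  Received packets are grouped by
  sender.\<close>

record 'a repair_scheme =
  send1 :: "nat \<Rightarrow> nat \<Rightarrow> 'a list \<Rightarrow> 'a list"
  send2 :: "nat \<Rightarrow> nat \<Rightarrow> (nat \<Rightarrow> 'a list) \<Rightarrow> 'a list"
  recover :: "nat \<Rightarrow> (nat \<Rightarrow> 'a list) \<Rightarrow> (nat \<Rightarrow> 'a list) \<Rightarrow> 'a list"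

text \<open>Below, \<open>S\<close> is the set of surviving nodes, \<open>F\<close> the set of failed nodes (equivalently, of
  newcomers), and \<open>c\<close> gives the content of every node before the failure.\<close>

definition received1 ::
  "'a repair_scheme \<Rightarrow> nat set \<Rightarrow> (nat \<Rightarrow> 'a list) \<Rightarrow> nat \<Rightarrow> nat \<Rightarrow> 'a list" where
  "received1 P S c t = (\<lambda>s\<in>S. send1 P s t (c s))"

definition received2 ::
  "'a repair_scheme \<Rightarrow> nat set \<Rightarrow> nat set \<Rightarrow> (nat \<Rightarrow> 'a list) \<Rightarrow> nat \<Rightarrow> nat \<Rightarrow> 'a list" where
  "received2 P S F c t = (\<lambda>u\<in>F - {t}. send2 P u t (received1 P S c u))"

definition recovered ::
  "'a repair_scheme \<Rightarrow> nat set \<Rightarrow> nat set \<Rightarrow> (nat \<Rightarrow> 'a list) \<Rightarrow> nat \<Rightarrow> 'a list" where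
  "recovered P S F c t = recover P t (received1 P S c t) (received2 P S F c t)"

definition repair_bandwidth ::
  "'a repair_scheme \<Rightarrow> nat set \<Rightarrow> nat set \<Rightarrow> (nat \<Rightarrow> 'a list) \<Rightarrow> nat \<Rightarrow> nat" where
  "repair_bandwidth P S F c t =
     (\<Sum>s\<in>S. length (received1 P S c t s)) + (\<Sum>u\<in>F - {t}. length (received2 P S F c t u))"

definition total_traffic ::
  "'a repair_scheme \<Rightarrow> nat set \<Rightarrow> nat set \<Rightarrow> (nat \<Rightarrow> 'a list) \<Rightarrow> nat" where
  "total_traffic P S F c = (\<Sum>t\<in>F. repair_bandwidth P S F c t)"

text \<open>The lower bound on the repair-bandwidth per failed node for file size \<open>B\<close>, where \<open>d \<ge> k\<close>.\<close>

definition repair_bandwidth_bound :: "nat \<Rightarrow> nat \<Rightarrow> nat \<Rightarrow> nat \<Rightarrow> real" where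
  "repair_bandwidth_bound B k d r =
     real B * (2 * real d + real r - 1) / (real k * (2 * real d + real r - real k))"

end

(* Any k columns of an MDS generator matrix determine a vector of length k from its inner products
   with them, because two codewords agreeing in k positions coincide.  A node outside a set of k
   nodes contributes to each of them one such inner product of its row vector, with distinct columns
   of the generator matrix, which yields reconstruction.  For repair, each survivor sends to newcomer
   t its inner product involving the row of t, and the inner product of its own row that t must store.
   After the first phase every newcomer knows its own row, and in the second phase it computes from
   it the missing inner products of the other newcomers. *)

theory Submission
  imports Defs "Jordan_Normal_Form.DL_Rank"
begin

lemma min_distance_le:
  assumes "u \<in> C" "w \<in> C" "u \<noteq> w"
  shows "min_distance C \<le> hamming_distance u w"
  unfolding min_distance_def using assms by (intro cInf_lower) auto

text \<open>A nonzero vector in the kernel of the transpose would be a linear dependency among the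
  rows of \<open>G\<close>. Distinctness of the rows enters because independence is stated for their
  set.\<close>

lemma generator_matrix_inj:
  fixes G :: "'a::field mat"
  assumes G: "generator_matrix N k C G"
    and x: "x \<in> carrier_vec k" and y: "y \<in> carrier_vec k"
    and eq: "G\<^sup>T *\<^sub>v x = G\<^sup>T *\<^sub>v y"
  shows "x = y"
proof (rule ccontr)
  assume "x \<noteq> y"
  interpret vec_space "TYPE('a)" N .
  have Gc: "G\<^sup>T \<in> carrier_mat N k" and dist: "distinct (cols G\<^sup>T)"
    and ind: "lin_indpt (set (cols G\<^sup>T))"
    using G by (auto simp: generator_matrix_def)
  have "G\<^sup>T *\<^sub>v (x - y) = 0\<^sub>v N"
    using Gc x y eq by (simp add: mult_minus_distrib_mat_vec[of _ N k])
  moreover have "x - y \<noteq> 0\<^sub>v k"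
    using \<open>x \<noteq> y\<close> x y
    by (metis eq_iff_diff_eq_0 index_minus_vec(1) index_zero_vec(1) carrier_vecD eq_vecI)
  ultimately show False
    using lin_depI[OF Gc minus_carrier_vec[OF x y] _ _ dist] ind by simp
qed

text \<open>The inner products are coordinates of the codewords encoding \<open>x\<close> and
  \<open>y\<close>. Agreement in \<open>k\<close> of them leaves at most \<open>N - k\<close>
  differences, below the minimum distance \<open>N - k + 1\<close>, so the codewords coincide and
  injectivity of the encoding applies.\<close>

lemma mds_inner_products_determine:
  fixes G :: "'a::field mat"
  assumes mds: "mds_code N k C" and G: "generator_matrix N k C G"
    and J: "J \<subseteq> {1..N}" "card J = k"
    and x: "x \<in> carrier_vec k" and y: "y \<in> carrier_vec k"
    and eq: "\<And>j. j \<in> J \<Longrightarrow> x \<bullet> col G (j - 1) = y \<bullet> col G (j - 1)"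
  shows "x = y"
proof (rule generator_matrix_inj[OF G x y], rule ccontr)
  assume neq: "G\<^sup>T *\<^sub>v x \<noteq> G\<^sup>T *\<^sub>v y"
  have J_less: "j - 1 < N" if "j \<in> J" for j
  proof -
    have "j \<in> {1..N}" using that J by blast
    then show ?thesis by auto
  qed
  have Gc: "G \<in> carrier_mat k N" and C: "C = vec_space.row_space N G"
    using G by (auto simp: generator_matrix_def)
  have codeword: "G\<^sup>T *\<^sub>v z \<in> C" if "z \<in> carrier_vec k" for z
    unfolding C vec_space.row_space_eq[OF Gc] using that Gc by auto
  have entry: "(G\<^sup>T *\<^sub>v z) $ i = z \<bullet> col G i" if "z \<in> carrier_vec k" "i < N" for z i
    using that Gc by (simp add: comm_scalar_prod[of _ k])
  have "N - k + 1 \<le> hamming_distance (G\<^sup>T *\<^sub>v x) (G\<^sup>T *\<^sub>v y)"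
    using min_distance_le[OF codeword[OF x] codeword[OF y] neq] mds by (simp add: mds_code_def)
  also have "\<dots> \<le> card ({..<N} - (\<lambda>j. j - 1) ` J)"
    unfolding hamming_distance_def
  proof (rule card_mono, simp, safe)
    fix i j assume "j \<in> J" "(G\<^sup>T *\<^sub>v x) $ (j - 1) \<noteq> (G\<^sup>T *\<^sub>v y) $ (j - 1)"
    then show False using J_less[of j] eq x y by (simp add: entry)
  qed (use Gc in auto)
  also have "\<dots> = N - k"
  proof -
    \<comment> \<open>\<open>J\<close> avoids 0, which truncated subtraction would identify with
      1.\<close>
    have "inj_on (\<lambda>j. j - 1) J" by (rule inj_on_subset[OF _ J(1)]) (auto intro!: inj_onI)
    moreover have "(\<lambda>j. j - 1) ` J \<subseteq> {..<N}" using J_less by auto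
    ultimately show ?thesis
      using J by (simp add: card_Diff_subset card_image finite_subset[OF J(1)])
  qed
  finally show False by simp
qed

text \<open>Inverse of \<open>node_add\<close> in its second argument: for distinct nodes, the
  product of the row of \<open>t\<close> stored at \<open>s\<close> uses column number
  \<open>node_offset n s t\<close>. For \<open>s = t\<close> the value is \<open>n\<close>.\<close>

definition node_offset :: "nat \<Rightarrow> nat \<Rightarrow> nat \<Rightarrow> nat" where
  "node_offset n s t = (if s < t then t - s else n + t - s)"

lemma node_offset_bounds:
  assumes "s \<in> {1..n}" "t \<in> {1..n}" "s \<noteq> t"
  shows "node_offset n s t \<in> {1..n - 1}"
  using assms by (auto simp: node_offset_def)

lemma node_add_offset:
  assumes "s \<in> {1..n}" "t \<in> {1..n}"
  shows "node_add n s (node_offset n s t) = t"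
  using assms by (auto simp: node_offset_def node_add_def)

lemma node_offset_add:
  assumes "t \<in> {1..n}" "j \<in> {1..<n}"
  shows "node_offset n t (node_add n t j) = j"
  using assms by (auto simp: node_offset_def node_add_def)

lemma node_add_other:
  assumes "t \<in> {1..n}" "j \<in> {1..<n}"
  shows "node_add n t j \<in> {1..n} - {t}"
  using assms by (auto simp: node_add_def)

text \<open>An equality \<open>t - s = n + t - s'\<close> would force \<open>s' = n + s\<close>,
  outside \<open>{1..n}\<close>. Hence the products of one row held by different nodes use different
  columns.\<close>

lemma inj_on_node_offset: "inj_on (\<lambda>s. node_offset n s t) {1..n}"
  by (rule inj_onI) (auto simp: node_offset_def split: if_splits)

lemma take_node_content:
  "x i \<in> carrier_vec k \<Longrightarrow> vec_of_list (take k (node_content G n x i)) = x i"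
  by (simp add: node_content_def vec_list)

text \<open>The row of \<open>s\<close> fills the first \<open>k\<close> positions. The product for
  offset \<open>j\<close> then sits at position \<open>j - 1\<close> of the tail, since
  \<open>[1..<n]\<close> starts at 1.\<close>

lemma nth_node_content:
  assumes "x s \<in> carrier_vec k" "s \<in> {1..n}" "t \<in> {1..n}" "s \<noteq> t"
  shows "node_content G n x s ! (k + node_offset n s t - 1) = x t \<bullet> col G (node_offset n s t - 1)"
proof -
  let ?j = "node_offset n s t"
  have j: "?j \<in> {1..n - 1}" by (rule node_offset_bounds[OF assms(2-4)])
  then have "k + ?j - 1 = length (list_of_vec (x s)) + (?j - 1)" using assms by simp
  then have "node_content G n x s ! (k + ?j - 1)
      = map (\<lambda>j. x (node_add n s j) \<bullet> col G (j - 1)) [1..<n] ! (?j - 1)"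
    by (simp only: node_content_def nth_append_length_plus)
  also have "\<dots> = x t \<bullet> col G (?j - 1)"
    using j node_add_offset[OF assms(2,3)] by (subst nth_map) auto
  finally show ?thesis .
qed

lemma files_carrier: "x \<in> files n k \<Longrightarrow> i \<in> {1..n} \<Longrightarrow> x i \<in> carrier_vec k"
  by (auto simp: files_def PiE_iff)

text \<open>The offsets from \<open>S\<close> to \<open>t\<close> are \<open>k\<close> distinct
  column numbers. The vectors are arbitrary so that the lemma serves both to compare two files and
  to show that decoding is unique.\<close>

lemma mds_row_determined:
  fixes G :: "'a::field mat"
  assumes "mds_code (n - 1) k C" "generator_matrix (n - 1) k C G"
    and "S \<subseteq> {1..n}" "card S = k" "t \<in> {1..n} - S"
    and "u \<in> carrier_vec k" "w \<in> carrier_vec k"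
    and "\<And>s. s \<in> S \<Longrightarrow>
      u \<bullet> col G (node_offset n s t - 1) = w \<bullet> col G (node_offset n s t - 1)"
  shows "u = w"
proof (rule mds_inner_products_determine[OF assms(1,2), where J = "(\<lambda>s. node_offset n s t) ` S"])
  show "(\<lambda>s. node_offset n s t) ` S \<subseteq> {1..n - 1}"
    using node_offset_bounds[of _ n t] assms(3,5) by blast
  show "card ((\<lambda>s. node_offset n s t) ` S) = k"
    using assms(3,4) by (simp add: card_image inj_on_subset[OF inj_on_node_offset])
qed (use assms in auto)

lemma inj_on_restrict_node_content:
  fixes G :: "'a::field mat"
  assumes code: "mds_code (n - 1) k C" "generator_matrix (n - 1) k C G"
    and S: "S \<subseteq> {1..n}" "card S = k"
  shows "inj_on (\<lambda>x. restrict (node_content G n x) S) (files n k)"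
proof (rule inj_onI)
  fix x y assume x: "x \<in> files n k" and y: "y \<in> files n k"
    and "restrict (node_content G n x) S = restrict (node_content G n y) S"
  then have eq: "node_content G n x s = node_content G n y s" if "s \<in> S" for s
    using that by (metis restrict_apply')
  have "x i = y i" if i: "i \<in> {1..n}" for i
  proof (cases "i \<in> S")
    case True
    with i show ?thesis
      using x y eq take_node_content[of x i k G n] take_node_content[of y i k G n]
      by (simp add: files_carrier)
  next
    case False
    show ?thesis
    proof (rule mds_row_determined[OF code S, of i])
      fix s assume "s \<in> S"
      then have "s \<in> {1..n}" "s \<noteq> i" using S False by auto
      then show "x i \<bullet> col G (node_offset n s i - 1) = y i \<bullet> col G (node_offset n s i - 1)"
        using nth_node_content[of x s k n i G] nth_node_content[of y s k n i G] x y i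
          eq[OF \<open>s \<in> S\<close>] by (simp add: files_carrier)
    qed (use x y i False in \<open>auto simp: files_carrier\<close>)
  qed
  \<comment> \<open>Files are extensional functions, so agreement on \<open>{1..n}\<close>
    suffices.\<close>
  then show "x = y" using x y unfolding files_def by (intro PiE_ext) auto
qed

text \<open>Choice stands in for solving the linear system given by the first packet from each
  survivor; on packets coming from a file the solution exists and is unique.\<close>

definition decode_row :: "'a::field mat \<Rightarrow> nat \<Rightarrow> nat \<Rightarrow> nat set \<Rightarrow> nat \<Rightarrow> (nat \<Rightarrow> 'a list) \<Rightarrow> 'a vec" where
  "decode_row G n k S t p =
     (SOME v. v \<in> carrier_vec k \<and> (\<forall>s\<in>S. v \<bullet> col G (node_offset n s t - 1) = p s ! 0))"

text \<open>Of the two packets from a survivor, entry 0 serves to decode the row of the newcomer and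
  entry 1 is copied into its new content. \<open>recover\<close> lists the products in storage
  order.\<close>

definition mds_repair :: "'a::field mat \<Rightarrow> nat \<Rightarrow> nat \<Rightarrow> nat set \<Rightarrow> 'a repair_scheme" where
  "mds_repair G n k S =
    \<lparr>send1 = (\<lambda>s t c. [c ! (k + node_offset n s t - 1),
        vec_of_list (take k c) \<bullet> col G (node_offset n t s - 1)]),
     send2 = (\<lambda>u t p. [decode_row G n k S u p \<bullet> col G (node_offset n t u - 1)]),
     recover = (\<lambda>t p p'. list_of_vec (decode_row G n k S t p) @
        map (\<lambda>j. let s = node_add n t j in if s \<in> S then p s ! 1 else p' s ! 0) [1..<n])\<rparr>"

text \<open>The lost row \<open>x t\<close> solves the system, and the MDS property excludes any
  other solution.\<close>

lemma decode_row_received: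
  fixes G :: "'a::field mat"
  assumes code: "mds_code (n - 1) k C" "generator_matrix (n - 1) k C G"
    and S: "S \<subseteq> {1..n}" "card S = k" and t: "t \<in> {1..n} - S" and x: "x \<in> files n k"
  shows "decode_row G n k S t (received1 (mds_repair G n k S) S (node_content G n x) t) = x t"
    (is "decode_row G n k S t ?p = _")
proof -
  have p: "x t \<bullet> col G (node_offset n s t - 1) = ?p s ! 0" if "s \<in> S" for s
  proof -
    have "s \<in> {1..n}" "s \<noteq> t" using that S t by auto
    then show ?thesis using that t x nth_node_content[of x s k n t G]
      by (simp add: received1_def mds_repair_def files_carrier)
  qed
  show ?thesis unfolding decode_row_def
  proof (rule some_equality)
    fix v assume v: "v \<in> carrier_vec k \<and>
      (\<forall>s\<in>S. v \<bullet> col G (node_offset n s t - 1) = ?p s ! 0)"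
    show "v = x t"
      by (rule mds_row_determined[OF code S t]) (use v p x t in \<open>auto simp: files_carrier\<close>)
  qed (use p x t in \<open>auto simp: files_carrier\<close>)
qed

lemma length_received1_mds_repair:
  "s \<in> S \<Longrightarrow> length (received1 (mds_repair G n k S) S c t s) = 2"
  by (simp add: received1_def mds_repair_def)

lemma length_received2_mds_repair:
  "u \<in> F - {t} \<Longrightarrow> length (received2 (mds_repair G n k S) S F c t u) = 1"
  by (simp add: received2_def mds_repair_def)

lemma recovered_mds_repair:
  fixes G :: "'a::field mat"
  assumes code: "mds_code (n - 1) k C" "generator_matrix (n - 1) k C G"
    and S: "S = {1..n} - F" "card S = k" and F: "F \<subseteq> {1..n}" "t \<in> F" and x: "x \<in> files n k"
  shows "recovered (mds_repair G n k S) S F (node_content G n x) t = node_content G n x t"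
proof -
  let ?P = "mds_repair G n k S" and ?c = "node_content G n x"
  have dec: "decode_row G n k S u (received1 ?P S ?c u) = x u" if "u \<in> F" for u
    using decode_row_received[OF code _ S(2) _ x, of u] S F that by auto
  have "(if m \<in> S then received1 ?P S ?c t m ! 1 else received2 ?P S F ?c t m ! 0)
      = x m \<bullet> col G (j - 1)"
    if j: "j \<in> {1..<n}" and m: "m = node_add n t j" for j m
  proof -
    have t: "t \<in> {1..n}" using F by auto
    \<comment> \<open>The sender \<open>m\<close> thus multiplies its row by the very column that
      \<open>t\<close> needs in place \<open>j\<close>.\<close>
    have off: "node_offset n t m = j" unfolding m by (rule node_offset_add[OF t j])
    have m': "m \<in> {1..n}" "m \<noteq> t" using node_add_other[OF t j] m by auto
    show ?thesis
    proof (cases "m \<in> S")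
      case True
      have "vec_of_list (take k (?c m)) = x m"
        using files_carrier[OF x m'(1)] by (rule take_node_content)
      with True off show ?thesis by (simp add: received1_def mds_repair_def)
    next
      case False
      then have mF: "m \<in> F" using m' S by auto
      show ?thesis
        using dec[OF mF] False mF m' off by (simp add: received2_def mds_repair_def)
    qed
  qed
  then have "map (\<lambda>j. let s = node_add n t j in
        if s \<in> S then received1 ?P S ?c t s ! 1 else received2 ?P S F ?c t s ! 0) [1..<n]
      = map (\<lambda>j. x (node_add n t j) \<bullet> col G (j - 1)) [1..<n]"
    by (auto simp: Let_def)
  then show ?thesis
    unfolding recovered_def by (subst mds_repair_def) (simp add: dec[OF F(2)] node_content_def)
qed

lemma repair_bandwidth_mds_repair:
  assumes "finite F" "t \<in> F"
  shows "repair_bandwidth (mds_repair G n k S) S F c t = 2 * card S + card F - 1"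
proof -
  \<comment> \<open>Positivity makes \<open>2 * card S + (card F - 1)\<close> equal to
    \<open>2 * card S + card F - 1\<close> under truncated subtraction.\<close>
  have "card F > 0" using assms card_gt_0_iff by blast
  with assms show ?thesis
    by (simp add: repair_bandwidth_def length_received1_mds_repair length_received2_mds_repair)
qed

theorem mainTheorem2:
  fixes k r d n B :: nat
    and C :: "'a::{field,finite} vec set"
    and G :: "'a mat"
  assumes "k > 0" and "r > 0"
    and "d = k" and "n = d + r" and "B = k * (2 * d + r - k)"
    and "mds_code (n - 1) k C"
    and "generator_matrix (n - 1) k C G"
  shows "B = k * n \<and>
    (\<forall>S. S \<subseteq> {1..n} \<and> card S = k \<longrightarrow>
      (\<exists>decode. \<forall>x \<in> files n k. decode (restrict (node_content G n x) S) = x)) \<and>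
    (\<forall>F. F \<subseteq> {1..n} \<and> card F = r \<longrightarrow>
      (let S = {1..n} - F in
        card S = d \<and>
        (\<exists>P :: 'a repair_scheme. \<forall>x \<in> files n k.
          (let c = node_content G n x in
            (\<forall>t \<in> F.
              (\<forall>s \<in> S. length (received1 P S c t s) = 2) \<and>
              (\<forall>u \<in> F - {t}. length (received2 P S F c t u) = 1) \<and>
              recovered P S F c t = c t \<and>
              repair_bandwidth P S F c t = 2 * d + r - 1 \<and>
              real (repair_bandwidth P S F c t) = repair_bandwidth_bound B k d r) \<and>
            total_traffic P S F c = r * (2 * d + r - 1)))))"
proof -
  have n: "n = k + r" and B: "B = k * n"
    using assms(1-5) by auto
  note code = assms(6,7)
  have decode: "\<exists>decode. \<forall>x \<in> files n k. decode (restrict (node_content G n x) S) = x"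
    if "S \<subseteq> {1..n}" "card S = k" for S
    using inv_into_f_f[OF inj_on_restrict_node_content[OF code that]] by blast
  \<comment> \<open>As \<open>d = k\<close>, the denominator \<open>k * (2 * d + r - k)\<close>
    equals \<open>k * n = B\<close>, which is nonzero and cancels.\<close>
  have bound: "real (2 * d + r - 1) = repair_bandwidth_bound B k d r"
    using assms(1-3) n B by (simp add: repair_bandwidth_bound_def of_nat_diff)
  have repair: "card S = d \<and> (\<exists>P :: 'a repair_scheme. \<forall>x \<in> files n k.
      (let c = node_content G n x in
        (\<forall>t \<in> F.
          (\<forall>s \<in> S. length (received1 P S c t s) = 2) \<and>
          (\<forall>u \<in> F - {t}. length (received2 P S F c t u) = 1) \<and>
          recovered P S F c t = c t \<and>
          repair_bandwidth P S F c t = 2 * d + r - 1 \<and>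
          real (repair_bandwidth P S F c t) = repair_bandwidth_bound B k d r) \<and>
        total_traffic P S F c = r * (2 * d + r - 1)))"
    if F: "F \<subseteq> {1..n}" "card F = r" and S: "S = {1..n} - F" for F S
  proof -
    have fin: "finite F" using F finite_subset by blast
    have cS: "card S = k" using F S n fin by (simp add: card_Diff_subset)
    have bw: "repair_bandwidth (mds_repair G n k S) S F c t = 2 * d + r - 1" if "t \<in> F" for c t
      using cS F assms(3) by (simp add: repair_bandwidth_mds_repair[OF fin that])
    have total: "total_traffic (mds_repair G n k S) S F c = r * (2 * d + r - 1)" for c
      by (simp add: total_traffic_def bw F(2))
    show ?thesis
      unfolding Let_def
      using cS assms(3) bound bw total recovered_mds_repair[OF code S cS F(1)]
      by (intro conjI exI[of _ "mds_repair G n k S"] ballI)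
        (auto simp: length_received1_mds_repair length_received2_mds_repair)
  qed
  show ?thesis
  proof (intro conjI allI impI, goal_cases)
    case 1
    show ?case by (rule B)
  next
    case (2 S)
    then show ?case by (intro decode) simp_all
  next
    case (3 F)
    show ?case
      unfolding Let_def[of "{1..n} - F"] by (rule repair) (use 3 in simp_all)
  qed
qed

end
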